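(* Let $n\in\mathbb{N}$ and let $f:\mathbb{R}^n\to\mathbb{R}$ be a differentiable function that is bounded below and whose gradient is Lipschitz continuous, i.e. there is $L>0$ with $\|\nabla f(x)-\nabla f(y)\|\le L\|x-y\|$ for all $x,y\in\mathbb{R}^n$. Let $c_1,c_2$ be constants with $0<c_1<c_2<1$. Let $(x_k)_{k\ge 0}$ be a sequence in $\mathbb{R}^n$ generated by a descent iteration $x_{k+1}=x_k+\alpha_k d_k$, where for every $k\ge 0$ the vector $d_k\in\mathbb{R}^n$ is a descent direction at $x_k$, i.e. $\langle\nabla f(x_k),d_k\rangle<0$, and the step size $\alpha_k>0$ satisfies the Wolfe conditions $$f(x_k+\alpha_k d_k)\le f(x_k)+c_1\alpha_k\langle\nabla f(x_k),d_k\rangle,\qquad \langle\nabla f(x_k+\alpha_k d_k),d_k\rangle\ge c_2\langle\nabla f(x_k),d_k\rangle .$$ Define $$\cos\theta_k=\frac{-\langle\nabla f(x_k),d_k\rangle}{\|\nabla f(x_k)\|\,\|d_k\|}.$$ Then $$\sum_{k=0}^{\infty}\cos^2\theta_k\,\|\nabla f(x_k)\|^2<\infty .$$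
   Context: $\langle x,y\rangle=\sum_{i=1}^n x_iy_i$ is the Euclidean inner product on $\mathbb{R}^n$ and $\|x\|=\sqrt{\langle x,x\rangle}$ is the Euclidean norm. *)

theory Defs
  imports "HOL-Analysis.Analysis"
begin

text \<open>The Riesz representative of the Frechet derivative; meaningful only where \<open>f\<close> is
  differentiable, see \<open>gderiv_gradient\<close>.\<close>
definition gradient :: "(real ^ 'n \<Rightarrow> real) \<Rightarrow> real ^ 'n \<Rightarrow> real ^ 'n"
  where "gradient f x = (THE D. GDERIV f x :> D)"

lemma gderiv_gradient:
  fixes f :: "real ^ 'n \<Rightarrow> real"
  assumes "f differentiable (at x)"
  shows "GDERIV f x :> gradient f x"
proof -
  obtain f' where f': "(f has_derivative f') (at x)"
    using assms unfolding differentiable_def by blast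

  have "f' h = h \<bullet> adjoint f' 1" for h
    using adjoint_works[OF bounded_linear.linear[OF has_derivative_bounded_linear[OF f']], of h 1] by simp
  then have "f' = (\<lambda>h. h \<bullet> adjoint f' 1)" by blast
  then have "GDERIV f x :> adjoint f' 1"
    using f' unfolding gderiv_def by simp
  moreover have "D = E" if D: "GDERIV f x :> D" and E: "GDERIV f x :> E" for D E
  proof -
    have "(\<lambda>h. h \<bullet> D) = (\<lambda>h. h \<bullet> E)"
      using D E unfolding gderiv_def by (rule has_derivative_unique)
    then show ?thesis by (metis vector_eq_ldot)
  qed
  ultimately show ?thesis unfolding gradient_def by (blast intro: theI)
qed

definition cos_angle :: "(real ^ 'n \<Rightarrow> real) \<Rightarrow> real ^ 'n \<Rightarrow> real ^ 'n \<Rightarrow> real"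
  where "cos_angle f x d = - (gradient f x \<bullet> d) / (norm (gradient f x) * norm d)"

end

theory Submission
  imports Defs
begin

text \<open>The curvature condition and the Lipschitz bound force
  \<open>\<alpha>\<^sub>k \<ge> (1 - c2) (- \<langle>\<nabla>f(x\<^sub>k), d\<^sub>k\<rangle>) / (L \<parallel>d\<^sub>k\<parallel>\<^sup>2)\<close>. Inserted into the sufficient decrease condition,
  this bounds each term of the series by a constant multiple of \<open>f(x\<^sub>k) - f(x\<^sub>k\<^sub>+\<^sub>1)\<close>; these
  decrements telescope, and \<open>f\<close> is bounded below.\<close>

text \<open>The partial sums telescope to at most \<open>C * (F 0 - m)\<close>, uniformly in
  \<open>n\<close>; for nonnegative terms this gives convergence.\<close>

lemma summable_le_decrements:
  fixes a F :: "nat \<Rightarrow> real"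
  assumes "\<And>k. 0 \<le> a k" and "\<And>k. a k \<le> C * (F k - F (Suc k))"
    and "0 \<le> C" and "\<And>k. m \<le> F k"
  shows "summable a"
proof (rule summableI_nonneg_bounded)
  fix n
  have "(\<Sum>k<n. a k) \<le> (\<Sum>k<n. C * (F k - F (Suc k)))"
    by (intro sum_mono assms)
  also have "\<dots> = C * (F 0 - F n)"
    by (simp only: sum_distrib_left [symmetric] sum_lessThan_telescope')
  also have "\<dots> \<le> C * (F 0 - m)"
    using assms(3,4) by (intro mult_left_mono) auto
  finally show "(\<Sum>k<n. a k) \<le> C * (F 0 - m)" .
qed (use assms(1) in auto)

text \<open>The gradient norm cancels. The case \<open>d = 0\<close> is covered because division by
  zero yields 0 on both sides.\<close>

lemma cos_angle_norm_gradient: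
  assumes "gradient f x \<noteq> 0"
  shows "(cos_angle f x d)\<^sup>2 * (norm (gradient f x))\<^sup>2 = (gradient f x \<bullet> d)\<^sup>2 / (norm d)\<^sup>2"
  using assms by (simp add: cos_angle_def power_divide power_mult_distrib)

text \<open>Subtracting \<open>g \<bullet> d\<close> from the curvature condition leaves
  \<open>(g' - g) \<bullet> d\<close>, which Cauchy-Schwarz and the Lipschitz bound control.\<close>

lemma curvature_condition_step_bound:
  fixes g d :: "'a::real_inner"
  assumes "norm (g' - g) \<le> L * norm (\<alpha> *\<^sub>R d)" and "0 < \<alpha>" and "c2 * (g \<bullet> d) \<le> g' \<bullet> d"
  shows "(1 - c2) * (- (g \<bullet> d)) \<le> L * \<alpha> * (norm d)\<^sup>2"
proof -
  have "(1 - c2) * (- (g \<bullet> d)) \<le> (g' - g) \<bullet> d"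
    using assms(3) by (simp add: algebra_simps)
  also have "\<dots> \<le> norm (g' - g) * norm d"
    by (rule norm_cauchy_schwarz)
  also have "\<dots> \<le> L * norm (\<alpha> *\<^sub>R d) * norm d"
    using assms(1) by (rule mult_right_mono) simp
  also have "\<dots> = L * \<alpha> * (norm d)\<^sup>2"
    using assms(2) by (simp add: power2_eq_square)
  finally show ?thesis .
qed

theorem theorem4p1:
  fixes f :: "real ^ 'n \<Rightarrow> real"
    and x d :: "nat \<Rightarrow> real ^ 'n"
    and \<alpha> :: "nat \<Rightarrow> real"
    and c1 c2 :: real
  assumes "\<And>y. f differentiable (at y)"
    and "bdd_below (range f)"
    and "\<exists>L>0. \<forall>y z. norm (gradient f y - gradient f z) \<le> L * norm (y - z)"
    and "0 < c1" and "c1 < c2" and "c2 < 1"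
    and "\<And>k. x (Suc k) = x k + \<alpha> k *\<^sub>R d k"
    and "\<And>k. gradient f (x k) \<bullet> d k < 0"
    and "\<And>k. \<alpha> k > 0"
    and "\<And>k. f (x k + \<alpha> k *\<^sub>R d k) \<le> f (x k) + c1 * \<alpha> k * (gradient f (x k) \<bullet> d k)"
    and "\<And>k. gradient f (x k + \<alpha> k *\<^sub>R d k) \<bullet> d k \<ge> c2 * (gradient f (x k) \<bullet> d k)"
  shows "summable (\<lambda>k. (cos_angle f (x k) (d k))\<^sup>2 * (norm (gradient f (x k)))\<^sup>2)"
proof -
  obtain L where "0 < L"
    and L: "\<And>y z. norm (gradient f y - gradient f z) \<le> L * norm (y - z)"
    using assms(3) by blast
  obtain m where m: "\<And>y. m \<le> f y"
    using assms(2) by (auto simp: bdd_below_def)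
  define s where "s k = - (gradient f (x k) \<bullet> d k)" for k
  have s: "0 < s k" for k
    using assms(8) by (simp add: s_def)
  \<comment> \<open>The factor \<open>L / (1 - c2)\<close> comes from the lower bound on the step
    size, \<open>1 / c1\<close> from sufficient decrease.\<close>
  define C where "C = L / (c1 * (1 - c2))"
  have "0 < C"
    using \<open>0 < L\<close> assms(4,6) by (simp add: C_def)
  have bound: "(s k)\<^sup>2 / (norm (d k))\<^sup>2 \<le> C * (f (x k) - f (x (Suc k)))" for k
  proof -
    have "0 < norm (d k)"
      using assms(8) [of k] by auto
    have "norm (gradient f (x k + \<alpha> k *\<^sub>R d k) - gradient f (x k)) \<le> L * norm (\<alpha> k *\<^sub>R d k)"
      using L [of "x k + \<alpha> k *\<^sub>R d k" "x k"] by simp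
    then have "(1 - c2) * s k \<le> L * \<alpha> k * (norm (d k))\<^sup>2"
      unfolding s_def using assms(9,11) by (rule curvature_condition_step_bound)
    then have "s k / (norm (d k))\<^sup>2 \<le> L / (1 - c2) * \<alpha> k"
      using \<open>0 < norm (d k)\<close> assms(6) by (simp add: field_simps)
    \<comment> \<open>Multiplying by \<open>s k\<close> produces the square on the left and, on the
      right, the product \<open>\<alpha> k * s k\<close> that sufficient decrease bounds.\<close>
    then have "s k / (norm (d k))\<^sup>2 * s k \<le> L / (1 - c2) * \<alpha> k * s k"
      using s [of k] by (intro mult_right_mono) auto
    also have "\<dots> = C * (c1 * \<alpha> k * s k)"
      using assms(4) by (simp add: C_def)
    also have "\<dots> \<le> C * (f (x k) - f (x (Suc k)))"
      using assms(10) [of k] \<open>0 < C\<close> by (intro mult_left_mono) (auto simp: s_def assms(7))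
    finally show ?thesis
      by (simp add: power2_eq_square)
  qed
  have "summable (\<lambda>k. (s k)\<^sup>2 / (norm (d k))\<^sup>2)"
    using bound \<open>0 < C\<close> m by (intro summable_le_decrements [where F = "\<lambda>k. f (x k)"]) auto
  \<comment> \<open>The descent condition rules out a zero gradient, and squaring removes the sign
    in \<open>s k\<close>.\<close>
  moreover have "(cos_angle f (x k) (d k))\<^sup>2 * (norm (gradient f (x k)))\<^sup>2
      = (s k)\<^sup>2 / (norm (d k))\<^sup>2" for k
    using assms(8) [of k] by (subst cos_angle_norm_gradient) (auto simp: s_def)
  ultimately show ?thesis
    by simp
qed

end
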